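(* Let $n\in\mathbb{N}$, let $S_1,\ldots,S_n$ be finite semigroups, let $S=\prod_{i=1}^n S_i$ be their direct product, and let $\mathit{NC}=\{i\in\{1,\ldots,n\}: S_i\text{ is not commutative}\}$. Suppose that $\mathit{NC}\neq\emptyset$. Then $\mathcal{G}(S)$ contains left paths if and only if at least one of the following conditions is satisfied: (1) There exists $i\in\mathit{NC}$ such that $\mathcal{G}(S_i)$ contains left paths. (2) There exists $i\in\{1,\ldots,n\}$ such that $\mathit{NC}\setminus\{i\}\neq\emptyset$ and $\mathcal{G}^*(S_i)$ contains $*$-left paths. Moreover, when $\mathcal{G}(S)$ has left paths we have $\mathrm{kd}(S)=\min(K\cup K^* )$, where $$K=\{\mathrm{kd}(S_i) : i\in\mathit{NC}\text{ and }\mathcal{G}(S_i)\text{ contains left paths}\},$$ $$K^*=\{\mathrm{kd}^*(S_i) : i\in\{1,\ldots,n\},\ \mathit{NC}\setminus\{i\}\neq\emptyset\text{ and }\mathcal{G}^*(S_i)\text{ contains }*\text{-left paths}\}.$$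
   Context: Semigroups are non-empty. The direct product $\prod_{i=1}^n S_i$ is the cartesian product with componentwise multiplication. The center of a semigroup $T$ is $Z(T)=\{x\in T: xy=yx \text{ for all } y\in T\}$ (possibly empty). For a finite non-commutative semigroup $T$, the commuting graph $\mathcal{G}(T)$ is the simple graph with vertex set $T\setminus Z(T)$ in which two distinct vertices $x,y$ are adjacent if and only if $xy=yx$. For any finite semigroup $T$ (commutative or not), the extended commuting graph $\mathcal{G}^*(T)$ is the simple graph with vertex set $T$ in which two distinct vertices $x,y$ are adjacent if and only if $xy=yx$. A left path in $\mathcal{G}(T)$ (respectively, a $*$-left path in $\mathcal{G}^*(T)$) is a path $x_1,\ldots,x_m$ in $\mathcal{G}(T)$ (respectively, in $\mathcal{G}^*(T)$), i.e. pairwise distinct vertices with consecutive ones adjacent, such that $x_1\neq x_m$ and $x_1x_i=x_mx_i$ for all $i\in\{1,\ldots,m\}$. Its length is its number of edges, $m-1$. If $\mathcal{G}(T)$ contains left paths, the knit degree $\mathrm{kd}(T)$ is the length of a shortest left path in $\mathcal{G}(T)$; if $\mathcal{G}^*(T)$ contains $*$-left paths, the $*$-knit degree $\mathrm{kd}^*(T)$ is the length of a shortest $*$-left path in $\mathcal{G}^*(T)$. *)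

theory Defs
  imports
    "HOL-Library.FuncSet"
    "HOL-Algebra.Congruence"
    "Graph_Theory.Graph_Theory"
begin

section \<open>Semigroups with explicit carriers\<close>

text \<open>
  HOL-Algebra has no semigroups, so its carrier record is extended by a binary operation only.
  The carrier may be any subset of the ambient type, so a family of semigroups
  \<open>S :: 'i \<Rightarrow> 'a sgrp\<close> may have pairwise different members; only the type of their elements is
  shared. Finite families of finite semigroups always fit into such a type (for instance
  \<open>nat\<close>) up to isomorphism.
\<close>

record 'a sgrp = "'a partial_object" +
  sgrp_mult :: "'a \<Rightarrow> 'a \<Rightarrow> 'a"  (infixl \<open>\<cdot>\<index>\<close> 70)

locale finite_semigroup =
  fixes T :: "'a sgrp" (structure)
  assumes carrier_nonempty: "carrier T \<noteq> {}"
    and carrier_finite: "finite (carrier T)"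
    and mult_closed: "\<lbrakk>x \<in> carrier T; y \<in> carrier T\<rbrakk> \<Longrightarrow> x \<cdot> y \<in> carrier T"
    and mult_assoc:
      "\<lbrakk>x \<in> carrier T; y \<in> carrier T; z \<in> carrier T\<rbrakk> \<Longrightarrow> (x \<cdot> y) \<cdot> z = x \<cdot> (y \<cdot> z)"

definition commutative_sgrp :: "'a sgrp \<Rightarrow> bool" where
  "commutative_sgrp T \<longleftrightarrow>
     (\<forall>x \<in> carrier T. \<forall>y \<in> carrier T. x \<cdot>\<^bsub>T\<^esub> y = y \<cdot>\<^bsub>T\<^esub> x)"

definition sgrp_center :: "'a sgrp \<Rightarrow> 'a set" where
  "sgrp_center T = {x \<in> carrier T. \<forall>y \<in> carrier T. x \<cdot>\<^bsub>T\<^esub> y = y \<cdot>\<^bsub>T\<^esub> x}"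

definition direct_product :: "'i set \<Rightarrow> ('i \<Rightarrow> 'a sgrp) \<Rightarrow> ('i \<Rightarrow> 'a) sgrp" where
  "direct_product I S =
     \<lparr> carrier = (\<Pi>\<^sub>E i\<in>I. carrier (S i)),
       sgrp_mult = (\<lambda>f g. \<lambda>i\<in>I. f i \<cdot>\<^bsub>S i\<^esub> g i) \<rparr>"

lemma finite_semigroup_direct_product:
  assumes "finite I" and "\<And>i. i \<in> I \<Longrightarrow> finite_semigroup (S i)"
  shows "finite_semigroup (direct_product I S)"
proof
  show "carrier (direct_product I S) \<noteq> {}"
    using finite_semigroup.carrier_nonempty[OF assms(2)]
    by (simp add: direct_product_def PiE_eq_empty_iff)
  show "finite (carrier (direct_product I S))"
    using assms(1) finite_semigroup.carrier_finite[OF assms(2)]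
    by (simp add: direct_product_def finite_PiE)
next
  fix f g assume "f \<in> carrier (direct_product I S)" "g \<in> carrier (direct_product I S)"
  then show "f \<cdot>\<^bsub>direct_product I S\<^esub> g \<in> carrier (direct_product I S)"
    by (auto simp: direct_product_def intro!: finite_semigroup.mult_closed[OF assms(2)])
next
  fix f g h
  assume "f \<in> carrier (direct_product I S)" "g \<in> carrier (direct_product I S)"
    "h \<in> carrier (direct_product I S)"
  then have "(f i \<cdot>\<^bsub>S i\<^esub> g i) \<cdot>\<^bsub>S i\<^esub> h i = f i \<cdot>\<^bsub>S i\<^esub> (g i \<cdot>\<^bsub>S i\<^esub> h i)" if "i \<in> I" for i
    using that by (auto simp: direct_product_def intro!: finite_semigroup.mult_assoc[OF assms(2)])
  then show "(f \<cdot>\<^bsub>direct_product I S\<^esub> g) \<cdot>\<^bsub>direct_product I S\<^esub> h =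
      f \<cdot>\<^bsub>direct_product I S\<^esub> (g \<cdot>\<^bsub>direct_product I S\<^esub> h)"
    by (simp add: direct_product_def cong: restrict_cong)
qed

section \<open>Commuting graphs\<close>

text \<open>
  Simple graphs are represented as in Graph_Theory, namely as loop-free symmetric digraphs
  without parallel arcs (\<open>pair_graph\<close>): an edge between \<open>x\<close> and \<open>y\<close> is
  the pair of arcs \<open>(x, y)\<close>, \<open>(y, x)\<close>. The commuting graph is only meaningful for a
  non-commutative semigroup; for a commutative one the definition yields the graph without vertices.
\<close>

definition commuting_graph :: "'a sgrp \<Rightarrow> 'a pair_pre_digraph" where
  "commuting_graph T =
     \<lparr> pverts = carrier T - sgrp_center T,
       parcs = {(x, y). x \<in> carrier T - sgrp_center T \<and> y \<in> carrier T - sgrp_center T \<and>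
                  x \<noteq> y \<and> x \<cdot>\<^bsub>T\<^esub> y = y \<cdot>\<^bsub>T\<^esub> x} \<rparr>"

definition ext_commuting_graph :: "'a sgrp \<Rightarrow> 'a pair_pre_digraph" where
  "ext_commuting_graph T =
     \<lparr> pverts = carrier T,
       parcs = {(x, y). x \<in> carrier T \<and> y \<in> carrier T \<and>
                  x \<noteq> y \<and> x \<cdot>\<^bsub>T\<^esub> y = y \<cdot>\<^bsub>T\<^esub> x} \<rparr>"

lemma pair_graph_commuting_graph:
  assumes "finite_semigroup T"
  shows "pair_graph (commuting_graph T)"
proof -
  have "finite (carrier T)" using assms by (rule finite_semigroup.carrier_finite)
  moreover have "parcs (commuting_graph T) \<subseteq> carrier T \<times> carrier T"
    by (auto simp: commuting_graph_def)
  ultimately have "finite (parcs (commuting_graph T))"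
    by (meson finite_SigmaI finite_subset)
  with \<open>finite (carrier T)\<close> show ?thesis
    by unfold_locales (auto simp: commuting_graph_def symmetric_def sym_def)
qed

lemma pair_graph_ext_commuting_graph:
  assumes "finite_semigroup T"
  shows "pair_graph (ext_commuting_graph T)"
proof -
  have "finite (carrier T)" using assms by (rule finite_semigroup.carrier_finite)
  moreover have "parcs (ext_commuting_graph T) \<subseteq> carrier T \<times> carrier T"
    by (auto simp: ext_commuting_graph_def)
  ultimately have "finite (parcs (ext_commuting_graph T))"
    by (meson finite_SigmaI finite_subset)
  with \<open>finite (carrier T)\<close> show ?thesis
    by unfold_locales (auto simp: ext_commuting_graph_def symmetric_def sym_def)
qed

section \<open>Left paths and knit degrees\<close>

text \<open>
  A path is its list of vertices; \<^const>\<open>vpath\<close> requires it to be non-empty, distinct and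
  consecutively adjacent, and \<^const>\<open>vwalk_length\<close> counts its edges.
\<close>

definition left_path :: "'a sgrp \<Rightarrow> 'a list \<Rightarrow> bool" where
  "left_path T p \<longleftrightarrow>
     vpath p (with_proj (commuting_graph T)) \<and> hd p \<noteq> last p \<and>
     (\<forall>x \<in> set p. hd p \<cdot>\<^bsub>T\<^esub> x = last p \<cdot>\<^bsub>T\<^esub> x)"

definition star_left_path :: "'a sgrp \<Rightarrow> 'a list \<Rightarrow> bool" where
  "star_left_path T p \<longleftrightarrow>
     vpath p (with_proj (ext_commuting_graph T)) \<and> hd p \<noteq> last p \<and>
     (\<forall>x \<in> set p. hd p \<cdot>\<^bsub>T\<^esub> x = last p \<cdot>\<^bsub>T\<^esub> x)"

definition has_left_paths :: "'a sgrp \<Rightarrow> bool" where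
  "has_left_paths T \<longleftrightarrow> (\<exists>p. left_path T p)"

definition has_star_left_paths :: "'a sgrp \<Rightarrow> bool" where
  "has_star_left_paths T \<longleftrightarrow> (\<exists>p. star_left_path T p)"

text \<open>The knit degrees are only meaningful if (\<open>*\<close>-)left paths exist.\<close>

definition knit_degree :: "'a sgrp \<Rightarrow> nat" where
  "knit_degree T = (LEAST k. \<exists>p. left_path T p \<and> vwalk_length p = k)"

definition star_knit_degree :: "'a sgrp \<Rightarrow> nat" where
  "star_knit_degree T = (LEAST k. \<exists>p. star_left_path T p \<and> vwalk_length p = k)"

end

theory Submission
  imports Defs
begin

text \<open>
  A left path of a factor can be inserted into one coordinate of the product, and a left path of the
  product can be projected to one coordinate.

  Lifting: fix an element of the product and let the \<open>i\<close>-th coordinate run through a path of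
  \<open>S i\<close> (\<open>left_path_in_lift\<close>). The coordinates other than \<open>i\<close> are constant, so they satisfy
  every commutation and every left-multiplication equation trivially; only non-centrality has to be
  arranged. An element of the product is central exactly when all its coordinates are
  (\<open>sgrp_center_direct_product\<close>). Hence a left path of \<open>S i\<close> can always be lifted, whereas a
  \<open>*\<close>-left path can be lifted as soon as some other coordinate can be given a non-central constant
  value, that is, as soon as some factor other than \<open>S i\<close> is non-commutative.

  Projecting: the ends of a left path of the product differ in some coordinate \<open>i\<close>. Its image in
  that coordinate is a walk between distinct elements, which may repeat vertices but can be cut down
  to a path among the same vertices (\<open>left_path_in_project\<close>). This is a \<open>*\<close>-left path of \<open>S i\<close>, which is what is
  wanted if some other factor is non-commutative. Otherwise \<open>S i\<close> is the only
  non-commutative factor, all other coordinates are central, and non-centrality in the product forces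
  non-centrality in coordinate \<open>i\<close>; the projection is then a left path of \<open>S i\<close>.

  Lifting preserves the length and projecting does not increase it, which gives the formula for the
  knit degree as well as the existence statement.
\<close>

section \<open>Left paths as lists of commuting elements\<close>

text \<open>
  Left paths and \<open>*\<close>-left paths differ only in the set \<open>V\<close> of admissible vertices. Commutation
  is used here instead of adjacency: it is reflexive, so it survives a projection that identifies
  consecutive vertices, and on distinct lists the two agree.
\<close>

definition left_path_in :: "'a sgrp \<Rightarrow> 'a set \<Rightarrow> 'a list \<Rightarrow> bool" where
  "left_path_in T V p \<longleftrightarrow>
     p \<noteq> [] \<and> distinct p \<and> set p \<subseteq> V \<and>
     successively (\<lambda>x y. x \<cdot>\<^bsub>T\<^esub> y = y \<cdot>\<^bsub>T\<^esub> x) p \<and> hd p \<noteq> last p \<and>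
     (\<forall>x \<in> set p. hd p \<cdot>\<^bsub>T\<^esub> x = last p \<cdot>\<^bsub>T\<^esub> x)"

lemma vwalk_arcs_subset_iff_successively:
  assumes "distinct p" and "set p \<subseteq> V"
    and "\<And>x y. (x, y) \<in> A \<longleftrightarrow> x \<in> V \<and> y \<in> V \<and> x \<noteq> y \<and> R x y"
  shows "set (vwalk_arcs p) \<subseteq> A \<longleftrightarrow> successively R p"
  using assms by (induction p rule: vwalk_arcs.induct) auto

lemma left_path_iff:
  "left_path T p \<longleftrightarrow> left_path_in T (carrier T - sgrp_center T) p"
proof -
  have "vpath p (with_proj (commuting_graph T)) \<longleftrightarrow>
      p \<noteq> [] \<and> distinct p \<and> set p \<subseteq> carrier T - sgrp_center T \<and>
      successively (\<lambda>x y. x \<cdot>\<^bsub>T\<^esub> y = y \<cdot>\<^bsub>T\<^esub> x) p"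
    using vwalk_arcs_subset_iff_successively[of p "carrier T - sgrp_center T"
        "parcs (commuting_graph T)" "\<lambda>x y. x \<cdot>\<^bsub>T\<^esub> y = y \<cdot>\<^bsub>T\<^esub> x"]
    by (auto simp: vpath_def vwalk_def commuting_graph_def)
  then show ?thesis
    unfolding left_path_def left_path_in_def by blast
qed

lemma star_left_path_iff: "star_left_path T p \<longleftrightarrow> left_path_in T (carrier T) p"
proof -
  have "vpath p (with_proj (ext_commuting_graph T)) \<longleftrightarrow>
      p \<noteq> [] \<and> distinct p \<and> set p \<subseteq> carrier T \<and>
      successively (\<lambda>x y. x \<cdot>\<^bsub>T\<^esub> y = y \<cdot>\<^bsub>T\<^esub> x) p"
    using vwalk_arcs_subset_iff_successively[of p "carrier T"
        "parcs (ext_commuting_graph T)" "\<lambda>x y. x \<cdot>\<^bsub>T\<^esub> y = y \<cdot>\<^bsub>T\<^esub> x"]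
    by (auto simp: vpath_def vwalk_def ext_commuting_graph_def)
  then show ?thesis
    unfolding star_left_path_def left_path_in_def by blast
qed

lemma knit_degree_attained:
  assumes "has_left_paths T"
  obtains p where "left_path T p" and "vwalk_length p = knit_degree T"
  using assms LeastI_ex[of "\<lambda>k. \<exists>p. left_path T p \<and> vwalk_length p = k"]
  unfolding has_left_paths_def knit_degree_def by blast

lemma star_knit_degree_attained:
  assumes "has_star_left_paths T"
  obtains p where "star_left_path T p" and "vwalk_length p = star_knit_degree T"
  using assms LeastI_ex[of "\<lambda>k. \<exists>p. star_left_path T p \<and> vwalk_length p = k"]
  unfolding has_star_left_paths_def star_knit_degree_def by blast

lemma knit_degree_le: "left_path T p \<Longrightarrow> knit_degree T \<le> vwalk_length p"
  unfolding knit_degree_def by (rule Least_le) blast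

lemma star_knit_degree_le: "star_left_path T p \<Longrightarrow> star_knit_degree T \<le> vwalk_length p"
  unfolding star_knit_degree_def by (rule Least_le) blast

section \<open>From walks to paths\<close>

text \<open>
  Erasing a closed piece \<open>y # ys @ [y]\<close> down to \<open>y\<close> keeps the list chained and keeps its ends.
\<close>

lemma successively_loop_erasure:
  assumes "successively R p" and "p \<noteq> []"
  obtains q where "q \<noteq> []" "distinct q" "successively R q" "set q \<subseteq> set p"
    "hd q = hd p" "last q = last p" "length q \<le> length p"
proof -
  have "\<exists>q. q \<noteq> [] \<and> distinct q \<and> successively R q \<and> set q \<subseteq> set p \<and>
      hd q = hd p \<and> last q = last p \<and> length q \<le> length p"
    using assms
  proof (induction "length p" arbitrary: p rule: less_induct)
    case less
    show ?case
    proof (cases "distinct p")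
      case True
      with less.prems show ?thesis by blast
    next
      case False
      then obtain xs ys zs y where p: "p = xs @ [y] @ ys @ [y] @ zs"
        using not_distinct_decomp by blast
      let ?r = "xs @ y # zs"
      have "length ?r < length p" "successively R ?r" "?r \<noteq> []"
        using less.prems by (auto simp: p successively_append_iff successively_Cons)
      from less.hyps[OF this] obtain q where
        "q \<noteq> []" "distinct q" "successively R q" "set q \<subseteq> set ?r"
        "hd q = hd ?r" "last q = last ?r" "length q \<le> length ?r"
        by blast
      moreover have "set ?r \<subseteq> set p" "hd ?r = hd p" "last ?r = last p" "length ?r \<le> length p"
        by (auto simp: p hd_append)
      ultimately show ?thesis
        by (metis order_trans)
    qed
  qed
  with that show ?thesis by blast
qed

section \<open>Paths in a direct product and in its factors\<close>

lemma carrier_direct_product: "carrier (direct_product I S) = (\<Pi>\<^sub>E i\<in>I. carrier (S i))"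
  by (simp add: direct_product_def)

text \<open>
  For the inclusion from left to right, a central \<open>f\<close> is tested against its own modifications
  \<open>f(i := y)\<close>, which are elements of the product differing from \<open>f\<close> at most in coordinate \<open>i\<close>.
\<close>

lemma sgrp_center_direct_product:
  "sgrp_center (direct_product I S) = (\<Pi>\<^sub>E i\<in>I. sgrp_center (S i))"
proof (intro equalityI subsetI)
  fix f assume f: "f \<in> sgrp_center (direct_product I S)"
  then have fc: "f \<in> (\<Pi>\<^sub>E i\<in>I. carrier (S i))"
    by (simp add: sgrp_center_def direct_product_def)
  have "f i \<cdot>\<^bsub>S i\<^esub> y = y \<cdot>\<^bsub>S i\<^esub> f i" if "i \<in> I" "y \<in> carrier (S i)" for i y
  proof -
    have "f(i := y) \<in> carrier (direct_product I S)"
      using fc that by (auto simp: direct_product_def PiE_iff extensional_def)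
    with f have "f \<cdot>\<^bsub>direct_product I S\<^esub> f(i := y) = f(i := y) \<cdot>\<^bsub>direct_product I S\<^esub> f"
      by (simp add: sgrp_center_def)
    from fun_cong[OF this, of i] that(1) show ?thesis
      by (simp add: direct_product_def)
  qed
  with fc show "f \<in> (\<Pi>\<^sub>E i\<in>I. sgrp_center (S i))"
    by (auto simp: PiE_iff sgrp_center_def)
next
  fix f assume "f \<in> (\<Pi>\<^sub>E i\<in>I. sgrp_center (S i))"
  then show "f \<in> sgrp_center (direct_product I S)"
    by (auto simp: PiE_iff sgrp_center_def direct_product_def intro!: restrict_ext)
qed

lemma left_path_in_lift:
  assumes "i \<in> I" and p: "left_path_in (S i) V p"
    and "\<And>x. x \<in> V \<Longrightarrow> c(i := x) \<in> W"
  shows "left_path_in (direct_product I S) W (map (\<lambda>x. c(i := x)) p)"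
proof -
  have inj: "inj (\<lambda>x. c(i := x))"
    by (rule injI) (metis fun_upd_same)
  have mult: "c(i := x) \<cdot>\<^bsub>direct_product I S\<^esub> c(i := y) = c(i := x') \<cdot>\<^bsub>direct_product I S\<^esub> c(i := y')"
    if "x \<cdot>\<^bsub>S i\<^esub> y = x' \<cdot>\<^bsub>S i\<^esub> y'" for x y x' y'
    using that by (auto simp: direct_product_def)
  show ?thesis
    using p assms(3) unfolding left_path_in_def
    by (auto simp: distinct_map inj_on_subset[OF inj] hd_map last_map successively_map
        inj_eq[OF inj] intro!: mult elim!: successively_mono)
qed

text \<open>
  The equations \<open>hd p \<cdot> x = last p \<cdot> x\<close> depend only on the two ends, so they survive the erasure
  of loops; only the distinctness of the ends is not inherited from the product.
\<close>

lemma left_path_in_project: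
  assumes "i \<in> I" and p: "left_path_in (direct_product I S) W p"
    and ends: "hd p i \<noteq> last p i"
    and "\<And>f. f \<in> W \<Longrightarrow> f i \<in> V"
  obtains q where "left_path_in (S i) V q" and "length q \<le> length p"
proof -
  let ?p = "map (\<lambda>f. f i) p"
  have mult: "f i \<cdot>\<^bsub>S i\<^esub> g i = f' i \<cdot>\<^bsub>S i\<^esub> g' i"
    if "f \<cdot>\<^bsub>direct_product I S\<^esub> g = f' \<cdot>\<^bsub>direct_product I S\<^esub> g'" for f g f' g'
    using fun_cong[OF that, of i] \<open>i \<in> I\<close> by (simp add: direct_product_def)
  have ne: "p \<noteq> []"
    using p by (simp add: left_path_in_def)
  have "successively (\<lambda>x y. x \<cdot>\<^bsub>S i\<^esub> y = y \<cdot>\<^bsub>S i\<^esub> x) ?p"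
    using p unfolding left_path_in_def successively_map
    by (auto intro: mult elim!: successively_mono)
  moreover have "?p \<noteq> []"
    using ne by simp
  ultimately obtain q where q: "q \<noteq> []" "distinct q"
    "successively (\<lambda>x y. x \<cdot>\<^bsub>S i\<^esub> y = y \<cdot>\<^bsub>S i\<^esub> x) q" "set q \<subseteq> set ?p"
    "hd q = hd ?p" "last q = last ?p" "length q \<le> length ?p"
    by (rule successively_loop_erasure)
  have hl: "hd q = hd p i" "last q = last p i"
    using q(5,6) ne by (simp_all add: hd_map last_map)
  have "\<forall>x \<in> set ?p. hd p i \<cdot>\<^bsub>S i\<^esub> x = last p i \<cdot>\<^bsub>S i\<^esub> x"
    using p by (auto simp: left_path_in_def intro: mult)
  moreover have "set ?p \<subseteq> V"
    using p assms(4) by (auto simp: left_path_in_def)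
  ultimately have "left_path_in (S i) V q"
    using q(1-4) ends unfolding left_path_in_def hl by blast
  with q(7) that show ?thesis by simp
qed

lemma commutative_sgrp_iff_center: "commutative_sgrp T \<longleftrightarrow> sgrp_center T = carrier T"
  by (auto simp: commutative_sgrp_def sgrp_center_def)

lemma left_path_direct_product_of_left_path:
  assumes nonempty: "\<And>i. i \<in> I \<Longrightarrow> carrier (S i) \<noteq> {}"
    and "i \<in> I" and "left_path (S i) p"
  shows "\<exists>q. left_path (direct_product I S) q \<and> vwalk_length q = vwalk_length p"
proof -
  from nonempty obtain c where c: "c \<in> (\<Pi>\<^sub>E j\<in>I. carrier (S j))"
    by (metis PiE_eq_empty_iff ex_in_conv)
  have noncentral: "c(i := x) \<in> carrier (direct_product I S) - sgrp_center (direct_product I S)"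
    if "x \<in> carrier (S i) - sgrp_center (S i)" for x
    using that c \<open>i \<in> I\<close>
    by (auto simp: sgrp_center_direct_product carrier_direct_product PiE_iff extensional_def)
  have "left_path (direct_product I S) (map (\<lambda>x. c(i := x)) p)"
    using assms(2,3) noncentral unfolding left_path_iff by (rule left_path_in_lift)
  then show ?thesis
    by (metis length_map vwalk_length_simp)
qed

lemma left_path_direct_product_of_star_left_path:
  assumes nonempty: "\<And>i. i \<in> I \<Longrightarrow> carrier (S i) \<noteq> {}"
    and "i \<in> I" and "star_left_path (S i) p"
    and "j \<in> I" and "j \<noteq> i" and "\<not> commutative_sgrp (S j)"
  shows "\<exists>q. left_path (direct_product I S) q \<and> vwalk_length q = vwalk_length p"
proof -
  from nonempty obtain d where d: "d \<in> (\<Pi>\<^sub>E j\<in>I. carrier (S j))"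
    by (metis PiE_eq_empty_iff ex_in_conv)
  from \<open>\<not> commutative_sgrp (S j)\<close> obtain z where z: "z \<in> carrier (S j) - sgrp_center (S j)"
    unfolding commutative_sgrp_iff_center by (auto simp: sgrp_center_def)
  have noncentral: "(d(j := z))(i := x) \<in> carrier (direct_product I S) - sgrp_center (direct_product I S)"
    if "x \<in> carrier (S i)" for x
    using that d z assms(2,4,5)
    by (auto simp: sgrp_center_direct_product carrier_direct_product PiE_iff extensional_def)
  have "left_path (direct_product I S) (map (\<lambda>x. (d(j := z))(i := x)) p)"
    using assms(2,3) noncentral unfolding left_path_iff star_left_path_iff
    by (rule left_path_in_lift)
  then show ?thesis
    by (metis length_map vwalk_length_simp)
qed

text \<open>
  Which of the two outcomes occurs is decided by the coordinate in which the ends of the path differ.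
\<close>

lemma left_path_direct_product_cases:
  assumes p: "left_path (direct_product I S) p"
  obtains (left) i q where "i \<in> I" "\<not> commutative_sgrp (S i)" "left_path (S i) q"
      "vwalk_length q \<le> vwalk_length p"
  | (star) i j q where "i \<in> I" "j \<in> I" "j \<noteq> i" "\<not> commutative_sgrp (S j)" "star_left_path (S i) q"
      "vwalk_length q \<le> vwalk_length p"
proof -
  let ?P = "direct_product I S"
  have p': "left_path_in ?P (carrier ?P - sgrp_center ?P) p"
    using p by (simp add: left_path_iff)
  then have "hd p \<in> carrier ?P" "last p \<in> carrier ?P" "hd p \<noteq> last p"
    unfolding left_path_in_def using hd_in_set[of p] last_in_set[of p] by blast+
  then obtain i where i: "i \<in> I" "hd p i \<noteq> last p i"
    using PiE_ext[of "hd p" I "\<lambda>i. carrier (S i)" "last p"]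
    unfolding carrier_direct_product by blast
  show thesis
  proof (cases "\<exists>j \<in> I - {i}. \<not> commutative_sgrp (S j)")
    case True
    then obtain j where j: "j \<in> I" "j \<noteq> i" "\<not> commutative_sgrp (S j)" by blast
    have "f i \<in> carrier (S i)" if "f \<in> carrier ?P - sgrp_center ?P" for f
      using that i(1) by (auto simp: carrier_direct_product)
    with i(1) p' i(2) obtain q where "left_path_in (S i) (carrier (S i)) q" "length q \<le> length p"
      by (rule left_path_in_project)
    with i(1) j show thesis
      by (intro star) (auto simp: star_left_path_iff)
  next
    case False
    have noncentral: "f i \<in> carrier (S i) - sgrp_center (S i)"
      if "f \<in> carrier ?P - sgrp_center ?P" for f
    proof -
      have f: "f \<in> (\<Pi>\<^sub>E j\<in>I. carrier (S j))" "f \<notin> (\<Pi>\<^sub>E j\<in>I. sgrp_center (S j))"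
        using that by (simp_all add: sgrp_center_direct_product carrier_direct_product)
      then obtain j where "j \<in> I" "f j \<notin> sgrp_center (S j)"
        by (auto simp: PiE_iff)
      moreover from this f(1) have "\<not> commutative_sgrp (S j)"
        by (auto simp: commutative_sgrp_iff_center)
      ultimately have "f i \<notin> sgrp_center (S i)"
        using False by blast
      with f(1) i(1) show ?thesis by auto
    qed
    from i(1) p' i(2) noncentral
    obtain q where q: "left_path_in (S i) (carrier (S i) - sgrp_center (S i)) q"
      "length q \<le> length p"
      by (rule left_path_in_project)
    then have "\<not> commutative_sgrp (S i)"
      by (auto simp: left_path_in_def commutative_sgrp_iff_center)
    with i(1) q show thesis
      by (intro left) (auto simp: left_path_iff)
  qed
qed

section \<open>The knit degree of a direct product\<close>

theorem theorem4p10: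
  fixes n :: nat
    and S :: "nat \<Rightarrow> 'a sgrp"
    and NC :: "nat set"
    and K Kstar :: "nat set"
  assumes "\<And>i. i \<in> {1..n} \<Longrightarrow> finite_semigroup (S i)"
    and "NC = {i \<in> {1..n}. \<not> commutative_sgrp (S i)}"
    and "NC \<noteq> {}"
    and "K = {knit_degree (S i) | i. i \<in> NC \<and> has_left_paths (S i)}"
    and "Kstar = {star_knit_degree (S i) | i.
                    i \<in> {1..n} \<and> NC - {i} \<noteq> {} \<and> has_star_left_paths (S i)}"
  shows "(has_left_paths (direct_product {1..n} S) \<longleftrightarrow>
            (\<exists>i \<in> NC. has_left_paths (S i)) \<or>
            (\<exists>i \<in> {1..n}. NC - {i} \<noteq> {} \<and> has_star_left_paths (S i)))
       \<and> (has_left_paths (direct_product {1..n} S) \<longrightarrow>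
            knit_degree (direct_product {1..n} S) = Min (K \<union> Kstar))"
proof -
  let ?P = "direct_product {1..n} S"
  have nonempty: "carrier (S i) \<noteq> {}" if "i \<in> {1..n}" for i
    using assms(1)[OF that] by (rule finite_semigroup.carrier_nonempty)
  have lift: "\<exists>q. left_path ?P q \<and> vwalk_length q = k" if "k \<in> K \<union> Kstar" for k
  proof (cases "k \<in> K")
    case True
    then obtain i where i: "i \<in> {1..n}" "has_left_paths (S i)" "k = knit_degree (S i)"
      using assms(2,4) by auto
    from i(2) obtain p where "left_path (S i) p" "vwalk_length p = knit_degree (S i)"
      by (rule knit_degree_attained)
    with left_path_direct_product_of_left_path[of "{1..n}" S i p] nonempty i show ?thesis
      by simp
  next
    case False
    with that obtain i j where i: "i \<in> {1..n}" "has_star_left_paths (S i)"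
      "k = star_knit_degree (S i)" and j: "j \<in> {1..n}" "j \<noteq> i" "\<not> commutative_sgrp (S j)"
      using assms(2,5) by auto
    from i(2) obtain p where "star_left_path (S i) p" "vwalk_length p = star_knit_degree (S i)"
      by (rule star_knit_degree_attained)
    with left_path_direct_product_of_star_left_path[of "{1..n}" S i p j] nonempty i j
    show ?thesis by simp
  qed
  have project: "\<exists>k \<in> K \<union> Kstar. k \<le> vwalk_length p" if "left_path ?P p" for p
    using that
  proof (rule left_path_direct_product_cases)
    fix i q
    assume left: "i \<in> {1..n}" "\<not> commutative_sgrp (S i)" "left_path (S i) q"
      "vwalk_length q \<le> vwalk_length p"
    then have "knit_degree (S i) \<in> K"
      using assms(2,4) by (auto simp: has_left_paths_def)
    with left(4) knit_degree_le[OF left(3)] show ?thesis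
      by (meson UnI1 order_trans)
  next
    fix i j q
    assume star: "i \<in> {1..n}" "j \<in> {1..n}" "j \<noteq> i" "\<not> commutative_sgrp (S j)"
      "star_left_path (S i) q" "vwalk_length q \<le> vwalk_length p"
    then have "star_knit_degree (S i) \<in> Kstar"
      using assms(2,5) by (auto simp: has_star_left_paths_def)
    with star(6) star_knit_degree_le[OF star(5)] show ?thesis
      by (meson UnI2 order_trans)
  qed
  have ex: "has_left_paths ?P \<longleftrightarrow> K \<union> Kstar \<noteq> {}"
    using lift project unfolding has_left_paths_def by blast
  have "knit_degree ?P = Min (K \<union> Kstar)" if "has_left_paths ?P"
  proof (rule Min_eqI[symmetric])
    have "finite NC"
      using assms(2) by simp
    then show "finite (K \<union> Kstar)"
      using assms(4,5) by simp
    show lower: "knit_degree ?P \<le> k" if "k \<in> K \<union> Kstar" for k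
      using lift[OF that] knit_degree_le by blast
    from that obtain p where "left_path ?P p" "vwalk_length p = knit_degree ?P"
      by (rule knit_degree_attained)
    with project obtain k where "k \<in> K \<union> Kstar" "k \<le> knit_degree ?P"
      by metis
    with lower show "knit_degree ?P \<in> K \<union> Kstar"
      by (metis order_antisym)
  qed
  moreover have "K \<union> Kstar \<noteq> {} \<longleftrightarrow> (\<exists>i \<in> NC. has_left_paths (S i)) \<or>
      (\<exists>i \<in> {1..n}. NC - {i} \<noteq> {} \<and> has_star_left_paths (S i))"
    unfolding assms(4,5) by blast
  ultimately show ?thesis
    using ex by blast
qed

end
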